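(* Let $M,N$ be weights of $\mathbb{R}^m,\mathbb{R}^n$, let $A\in\mathbb{R}^{m\times n}$ with $MA=AN$, and let $K\subseteq\mathbb{R}^n$ be a closed cone. Then $$(A\circ I\circ K)^{[*]}\subseteq (A^{[\dagger]})^{[*]}\circ I\circ K^{[*]}+\mathcal{N}\big((A\circ I)^{[*]}\big).$$ If moreover $A^{[\dagger]}\circ A\circ K\subseteq K$, then equality holds.
   Context: A weight is a real symmetric matrix $W$ with $W^2=I$. $\mathbb{R}^m$ and $\mathbb{R}^n$ carry weights $M\in\mathbb{R}^{m\times m}$ and $N\in\mathbb{R}^{n\times n}$, respectively. The indefinite inner product on the space with weight $W$ is $[x,y]=\langle x,Wy\rangle$. Indefinite matrix product: if $B$ has $p$ columns and $C$ has $p$ rows (or is a vector in $\mathbb{R}^p$), $p\in\{m,n\}$, and $W$ is the weight of $\mathbb{R}^p$, then $B\circ C:=BWC$. $I$ denotes an identity matrix of the appropriate size. Indefinite adjoint of $B\in\mathbb{R}^{p\times q}$: $B^{[*]}:=W_qB^TW_p$, where $W_p,W_q$ are the weights of $\mathbb{R}^p,\mathbb{R}^q$. Indefinite Moore–Penrose inverse: $A^{[\dagger]}$ is the unique $X\in\mathbb{R}^{n\times m}$ such that - $A\circ X\circ A=A$, - $X\circ A\circ X=X$, - $(A\circ X)^{[*]}=A\circ X$, - $(X\circ A)^{[*]}=X\circ A$. It equals $NA^\dagger M$. Range and null space: for a matrix $B$ with $q$ columns, $\mathcal{R}(B)=\{B\circ x:x\in\mathbb{R}^q\}$ and $\mathcal{N}(B)=\{x\in\mathbb{R}^q:B\circ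 x=0\}$. A cone is a nonempty set closed under addition and under multiplication by nonnegative scalars. For $S$ a subset of $\mathbb{R}^p$ with weight $W$, the dual is $S^{[*]}=\{x\in\mathbb{R}^p:[x,t]\ge0\ \forall t\in S\}$. For a matrix $B$ and a set $S$, $B\circ S=\{B\circ s:s\in S\}$. The sum of sets is the Minkowski sum. *)

theory Defs
  imports "HOL-Analysis.Analysis"
begin

text \<open>Vectors of R^p are real^'p, p x q matrices are real^'q^'p.
  A weight is a real symmetric matrix W with W^2 = I.\<close>

definition is_weight :: "real^'p^'p \<Rightarrow> bool" where
  "is_weight W \<longleftrightarrow> transpose W = W \<and> W ** W = mat 1"

text \<open>Indefinite product B o C = B W C, W the weight of the middle space.\<close>
definition imm :: "real^'p^'p \<Rightarrow> real^'p^'r \<Rightarrow> real^'q^'p \<Rightarrow> real^'q^'r" where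
  "imm W B C = B ** W ** C"

definition imv :: "real^'p^'p \<Rightarrow> real^'p^'r \<Rightarrow> real^'p \<Rightarrow> real^'r" where
  "imv W B x = B *v (W *v x)"

definition imset :: "real^'p^'p \<Rightarrow> real^'p^'r \<Rightarrow> (real^'p) set \<Rightarrow> (real^'r) set" where
  "imset W B S = (\<lambda>s. imv W B s) ` S"

text \<open>Indefinite adjoint of B in R^{p x q}: Wq B^T Wp.\<close>
definition iadj :: "real^'p^'p \<Rightarrow> real^'q^'q \<Rightarrow> real^'q^'p \<Rightarrow> real^'p^'q" where
  "iadj Wp Wq B = Wq ** transpose B ** Wp"

text \<open>Indefinite Moore-Penrose inverse (M weight of R^m, N weight of R^n, A in R^{m x n}).\<close>
definition impinv :: "real^'m^'m \<Rightarrow> real^'n^'n \<Rightarrow> real^'n^'m \<Rightarrow> real^'m^'n" where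
  "impinv M N A = (THE X. imm M (imm N A X) A = A \<and> imm N (imm M X A) X = X
      \<and> iadj M M (imm N A X) = imm N A X \<and> iadj N N (imm M X A) = imm M X A)"

text \<open>Null space of B (q columns, weight Wq of R^q).\<close>
definition inull :: "real^'q^'q \<Rightarrow> real^'q^'p \<Rightarrow> (real^'q) set" where
  "inull Wq B = {x. imv Wq B x = 0}"

definition is_cone :: "('a::real_vector) set \<Rightarrow> bool" where
  "is_cone K \<longleftrightarrow> K \<noteq> {} \<and> (\<forall>x\<in>K. \<forall>y\<in>K. x + y \<in> K) \<and> (\<forall>x\<in>K. \<forall>c::real. c \<ge> 0 \<longrightarrow> c *\<^sub>R x \<in> K)"

text \<open>Indefinite dual: {x. [x,t] >= 0 for all t in S}, [x,y] = <x, W y>.\<close>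
definition idual :: "real^'p^'p \<Rightarrow> (real^'p) set \<Rightarrow> (real^'p) set" where
  "idual W S = {x. \<forall>t\<in>S. inner x (W *v t) \<ge> 0}"

definition msum :: "('a::plus) set \<Rightarrow> 'a set \<Rightarrow> 'a set" where
  "msum S T = {a + b | a b. a \<in> S \<and> b \<in> T}"

end

theory Submission
  imports Defs
begin

(*
  Because the weights are involutions, A^[dagger] = N Y M with Y the ordinary Moore-Penrose
  inverse of A, and (using M A = A N) the statement becomes a Euclidean one about the set
  S = N K: every x splits as x = Y^T (A^T x) + (I - A Y) x. If x is dual to A S, then A^T x is
  dual to S, and (I - A Y) x lies in the null space of A^T since A^T A Y = A^T. Conversely
  <Y^T y + z, A s> = <y, Y A s> for A^T z = 0, which is nonnegative when y is dual to S and
  Y A S is contained in S.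
*)

lemma matrix_add_rdistrib: "((A::real^'n^'m) + B) ** (C::real^'p^'n) = A ** C + B ** C"
  by (simp add: matrix_eq matrix_vector_mul_assoc[symmetric] algebra_simps)

lemma matrix_diff_ldistrib: "(A::real^'n^'m) ** ((B::real^'p^'n) - C) = A ** B - A ** C"
  by (simp add: matrix_eq matrix_vector_mul_assoc[symmetric] algebra_simps)

lemma matrix_diff_rdistrib: "((A::real^'n^'m) - B) ** (C::real^'p^'n) = A ** C - B ** C"
  by (simp add: matrix_eq matrix_vector_mul_assoc[symmetric] algebra_simps)

lemma transpose_add: "transpose ((A::real^'n^'m) + B) = transpose A + transpose B"
  by (simp add: transpose_def vec_eq_iff)

lemma transpose_diff: "transpose ((A::real^'n^'m) - B) = transpose A - transpose B"
  by (simp add: transpose_def vec_eq_iff)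

lemma inner_matrix_vector_transpose: "(x::real^'m) \<bullet> ((B::real^'n^'m) *v y) = (transpose B *v x) \<bullet> y"
  by (metis dot_lmul_matrix transpose_matrix_vector)

lemma orthogonal_projection_matrix_exists:
  fixes S :: "(real^'m) set"
  assumes "subspace S"
  obtains P :: "real^'m^'m"
  where "transpose P = P" "\<And>x. P *v x \<in> S" "\<And>x. x \<in> S \<Longrightarrow> P *v x = x"
proof -
  obtain C where C: "C \<subseteq> S" "pairwise orthogonal C" "\<And>x. x \<in> C \<Longrightarrow> norm x = 1"
     "independent C" "span C = S"
    using orthonormal_basis_subspace[OF assms] by metis
  have fin: "finite C" using C(4) independent_imp_finite by blast
  define f where "f = (\<lambda>y::real^'m. \<Sum>c\<in>C. (c \<bullet> y) *\<^sub>R c)"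
  have lin: "linear f" unfolding f_def
    by (intro linearI) (simp_all add: inner_add_right scaleR_add_left sum.distrib scaleR_sum_right)
  define P where "P = matrix f"
  have Pv: "P *v x = f x" for x unfolding P_def using lin by (simp add: matrix_works)
  have range: "f x \<in> S" for x
    unfolding f_def using C(1) assms by (metis (no_types, lifting) C(5) span_scale span_sum span_base)
  have fixes_S: "f x = x" if "x \<in> S" for x
    using orthonormal_basis_expand[OF C(2) C(3), of x] C(5) fin that
    by (simp add: f_def inner_commute)
  have self_adjoint: "y \<bullet> f x = f y \<bullet> x" for x y
    unfolding f_def by (simp add: inner_sum_right inner_sum_left inner_commute mult.commute)
  have "transpose P *v x = P *v x" for x
  proof (rule vector_eq_ldot[THEN iffD1], intro allI)
    fix y
    have "y \<bullet> (transpose P *v x) = (P *v y) \<bullet> x"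
      by (metis dot_lmul_matrix transpose_matrix_vector transpose_transpose inner_commute vector_transpose_matrix)
    then show "y \<bullet> (transpose P *v x) = y \<bullet> (P *v x)" by (simp add: Pv self_adjoint)
  qed
  then have "transpose P = P" by (simp add: matrix_eq)
  moreover have "P *v x \<in> S" for x using Pv range by simp
  moreover have "P *v x = x" if "x \<in> S" for x using Pv fixes_S that by simp
  ultimately show thesis using that by blast
qed

definition moore_penrose :: "real^'n^'m \<Rightarrow> real^'m^'n \<Rightarrow> bool" where
  "moore_penrose A Y \<longleftrightarrow> A ** Y ** A = A \<and> Y ** A ** Y = Y
     \<and> transpose (A ** Y) = A ** Y \<and> transpose (Y ** A) = Y ** A"

text \<open>Existence follows the classical construction: with P the orthogonal projection onto the
  range of A, the matrix A A^T + (I - P) is invertible, and A^T (A A^T + (I - P))^-1 is the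
  Moore-Penrose inverse.\<close>

lemma gram_plus_projection_complement_injective:
  fixes A :: "real^'n^'m" and P :: "real^'m^'m"
  assumes P_sym: "transpose P = P" and P_idem: "P ** P = P"
    and P_range: "\<And>x. P *v x \<in> range ((*v) A)"
    and kernel: "(A ** transpose A + (mat 1 - P)) *v x = 0"
  shows "x = 0"
proof -
  have P_quadratic: "x \<bullet> (P *v x) = (P *v x) \<bullet> (P *v x)"
    by (metis P_sym P_idem inner_matrix_vector_transpose matrix_vector_mul_assoc)
  have "0 = x \<bullet> ((A ** transpose A + (mat 1 - P)) *v x)" using kernel by simp
  also have "\<dots> = (transpose A *v x) \<bullet> (transpose A *v x) + (x - P *v x) \<bullet> (x - P *v x)"
    by (simp add: matrix_vector_mult_add_rdistrib matrix_vector_mult_diff_rdistrib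
        matrix_vector_mul_assoc[symmetric] inner_diff_right inner_add_right inner_diff_left
        inner_matrix_vector_transpose[of x A] P_quadratic inner_commute[of "P *v x" x])
  finally have "transpose A *v x = 0" "x - P *v x = 0"
    by (smt (verit) inner_ge_zero inner_eq_zero_iff)+
  moreover obtain u where "P *v x = A *v u" using P_range by blast
  ultimately have "x \<bullet> x = 0"
    by (metis eq_iff_diff_eq_0 inner_matrix_vector_transpose inner_zero_left)
  then show ?thesis by simp
qed

lemma moore_penrose_of_gram_plus_projection_inverse:
  fixes A :: "real^'n^'m" and P :: "real^'m^'m"
  assumes P_sym: "transpose P = P" and PP: "P ** P = P" and PA: "P ** A = A"
    and HG: "H ** (A ** transpose A + (mat 1 - P)) = mat 1"
  shows "moore_penrose A (transpose A ** H)"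
proof -
  define G where "G = A ** transpose A + (mat 1 - P)"
  have HG: "H ** G = mat 1" using HG unfolding G_def .
  have GH: "G ** H = mat 1" using HG matrix_left_right_inverse by blast
  have AtP: "transpose A ** P = transpose A" by (metis PA P_sym matrix_transpose_mul)
  have G_sym: "transpose G = G"
    unfolding G_def by (simp add: transpose_add transpose_diff transpose_mat matrix_transpose_mul P_sym)
  have H_sym: "transpose H = H"
  proof -
    have HtG: "transpose H ** G = mat 1"
      by (metis GH G_sym matrix_transpose_mul transpose_mat)
    have "transpose H = transpose H ** (G ** H)" using GH by simp
    also have "\<dots> = H" by (metis matrix_mul_assoc matrix_mul_lid HtG)
    finally show ?thesis .
  qed
  have PG: "P ** G = A ** transpose A"
    unfolding G_def by (simp add: matrix_add_ldistrib matrix_diff_ldistrib PP) (metis matrix_mul_assoc PA)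
  have AY: "A ** (transpose A ** H) = P"
  proof -
    have "A ** (transpose A ** H) = P ** G ** H" by (simp add: PG matrix_mul_assoc)
    also have "\<dots> = P" by (metis matrix_mul_assoc GH matrix_mul_rid)
    finally show ?thesis .
  qed
  have "A ** transpose A ** P = A ** transpose A"
    by (metis matrix_mul_assoc AtP)
  then have "G ** (mat 1 - P) = mat 1 - P"
    unfolding G_def by (simp add: matrix_add_rdistrib matrix_diff_ldistrib matrix_diff_rdistrib PP)
  then have "H ** (mat 1 - P) = mat 1 - P"
    by (metis HG matrix_mul_assoc matrix_mul_lid)
  moreover have "transpose A ** (mat 1 - P) = 0"
    by (simp add: matrix_diff_ldistrib AtP)
  ultimately have "transpose A ** H ** (mat 1 - P) = 0"
    by (metis matrix_mul_assoc)
  then have YP: "transpose A ** H ** P = transpose A ** H"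
    by (simp add: matrix_diff_ldistrib)
  show ?thesis
    unfolding moore_penrose_def
  proof (intro conjI)
    show "A ** (transpose A ** H) ** A = A" by (simp add: AY PA)
    show "transpose A ** H ** A ** (transpose A ** H) = transpose A ** H"
      by (metis AY YP matrix_mul_assoc)
    show "transpose (A ** (transpose A ** H)) = A ** (transpose A ** H)" by (simp add: AY P_sym)
    show "transpose (transpose A ** H ** A) = transpose A ** H ** A"
      by (simp add: matrix_transpose_mul H_sym matrix_mul_assoc)
  qed
qed

lemma moore_penrose_exists:
  fixes A :: "real^'n^'m"
  obtains Y where "moore_penrose A Y"
proof -
  have "subspace (range ((*v) A))"
    using linear_subspace_image[OF matrix_vector_mul_linear[of A] subspace_UNIV] by simp
  then obtain P :: "real^'m^'m" where P: "transpose P = P" "\<And>x. P *v x \<in> range ((*v) A)"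
      "\<And>x. x \<in> range ((*v) A) \<Longrightarrow> P *v x = x"
    using orthogonal_projection_matrix_exists by blast
  have PA: "P ** A = A" by (simp add: matrix_eq matrix_vector_mul_assoc[symmetric] P(3))
  have PP: "P ** P = P" by (simp add: matrix_eq matrix_vector_mul_assoc[symmetric] P(2,3))
  have "(A ** transpose A + (mat 1 - P)) *v x = 0 \<Longrightarrow> x = 0" for x
    using gram_plus_projection_complement_injective[OF P(1) PP P(2)] .
  then obtain H where "H ** (A ** transpose A + (mat 1 - P)) = mat 1"
    using matrix_left_invertible_ker by blast
  then show thesis
    using that moore_penrose_of_gram_plus_projection_inverse[OF P(1) PP PA] by blast
qed

lemma moore_penrose_unique:
  assumes "moore_penrose A Y" "moore_penrose A Z"
  shows "Y = Z"
proof -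
  have Y: "A ** Y ** A = A" "Y ** A ** Y = Y" "transpose (A ** Y) = A ** Y" "transpose (Y ** A) = Y ** A"
    and Z: "A ** Z ** A = A" "Z ** A ** Z = Z" "transpose (A ** Z) = A ** Z" "transpose (Z ** A) = Z ** A"
    using assms unfolding moore_penrose_def by blast+
  have "Y = Y ** (A ** Y)" using Y(2) by (simp add: matrix_mul_assoc)
  also have "\<dots> = Y ** (transpose Y ** transpose A)" using Y(3) by (metis matrix_transpose_mul)
  also have "\<dots> = Y ** (transpose Y ** transpose (A ** Z ** A))" using Z(1) by simp
  also have "\<dots> = Y ** (transpose (A ** Y) ** transpose (A ** Z))"
    by (simp add: matrix_transpose_mul matrix_mul_assoc)
  also have "\<dots> = Y ** A ** Z" using Y(1,3) Z(3) by (simp add: matrix_mul_assoc)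
  finally have YAZ: "Y = Y ** A ** Z" .
  have "Z = Z ** A ** Z" using Z(2) by simp
  also have "\<dots> = transpose A ** transpose Z ** Z" using Z(4) by (metis matrix_transpose_mul)
  also have "\<dots> = transpose (A ** Y ** A) ** transpose Z ** Z" using Y(1) by simp
  also have "\<dots> = transpose (Y ** A) ** transpose (Z ** A) ** Z"
    by (simp add: matrix_transpose_mul matrix_mul_assoc)
  also have "\<dots> = Y ** A ** Z" using Y(4) Z(2,4) by (metis matrix_mul_assoc)
  finally show ?thesis using YAZ by simp
qed

lemma is_weight_transpose: "is_weight W \<Longrightarrow> transpose W = W"
  by (simp add: is_weight_def)

lemma is_weight_mult_self: "is_weight W \<Longrightarrow> W ** W = mat 1"
  by (simp add: is_weight_def)

lemma is_weight_mult_self_left: "is_weight W \<Longrightarrow> W ** (W ** B) = B"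
  by (metis is_weight_mult_self matrix_mul_assoc matrix_mul_lid)

lemma is_weight_mult_vec_self: "is_weight W \<Longrightarrow> W *v (W *v x) = x"
  by (simp add: matrix_vector_mul_assoc is_weight_mult_self)

lemma involution_sandwich_cancel:
  fixes P :: "real^'m^'m" and Q :: "real^'n^'n"
  assumes "P ** P = mat 1" "Q ** Q = mat 1"
  shows "P ** B ** Q = P ** C ** Q \<longleftrightarrow> B = C"
proof
  assume h: "P ** B ** Q = P ** C ** Q"
  have "B = P ** (P ** B ** Q) ** Q" using assms by (metis matrix_mul_assoc matrix_mul_lid matrix_mul_rid)
  also have "\<dots> = P ** (P ** C ** Q) ** Q" using h by simp
  also have "\<dots> = C" using assms by (metis matrix_mul_assoc matrix_mul_lid matrix_mul_rid)
  finally show "B = C" .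
qed simp

lemma indefinite_penrose_iff_moore_penrose:
  fixes M :: "real^'m^'m" and N :: "real^'n^'n" and A :: "real^'n^'m" and X :: "real^'m^'n"
  assumes wM: "is_weight M" and wN: "is_weight N"
  shows "(imm M (imm N A X) A = A \<and> imm N (imm M X A) X = X
      \<and> iadj M M (imm N A X) = imm N A X \<and> iadj N N (imm M X A) = imm M X A)
      \<longleftrightarrow> moore_penrose A (N ** X ** M)"
proof -
  note MM = is_weight_mult_self[OF wM] and NN = is_weight_mult_self[OF wN]
  note simps = matrix_mul_assoc[symmetric] matrix_transpose_mul is_weight_transpose[OF wM]
    is_weight_transpose[OF wN] MM NN is_weight_mult_self_left[OF wM] is_weight_mult_self_left[OF wN]
  define Z where "Z = N ** X ** M"
  have X: "X = N ** Z ** M" unfolding Z_def by (simp add: simps)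
  have I: "mat 1 ** mat 1 = (mat 1 :: real^'k^'k)" by simp
  have "imm M (imm N A X) A = A \<longleftrightarrow> A ** Z ** A = A"
    unfolding X imm_def by (simp add: simps)
  moreover have "imm N (imm M X A) X = N ** (Z ** A ** Z) ** M"
    unfolding X imm_def by (simp add: simps)
  then have "imm N (imm M X A) X = X \<longleftrightarrow> Z ** A ** Z = Z"
    using involution_sandwich_cancel[OF NN MM] X by simp
  moreover have "imm N A X = mat 1 ** (A ** Z) ** M"
    and "iadj M M (mat 1 ** (A ** Z) ** M) = mat 1 ** transpose (A ** Z) ** M"
    unfolding X imm_def iadj_def by (simp_all add: simps)
  then have "iadj M M (imm N A X) = imm N A X \<longleftrightarrow> transpose (A ** Z) = A ** Z"
    using involution_sandwich_cancel[OF I MM] by simp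
  moreover have "imm M X A = N ** (Z ** A) ** mat 1"
    and "iadj N N (N ** (Z ** A) ** mat 1) = N ** transpose (Z ** A) ** mat 1"
    unfolding X imm_def iadj_def by (simp_all add: simps)
  then have "iadj N N (imm M X A) = imm M X A \<longleftrightarrow> transpose (Z ** A) = Z ** A"
    using involution_sandwich_cancel[OF NN I] by simp
  ultimately show ?thesis unfolding moore_penrose_def Z_def by blast
qed

lemma impinv_eq_moore_penrose:
  fixes M :: "real^'m^'m" and N :: "real^'n^'n" and A :: "real^'n^'m"
  assumes wM: "is_weight M" and wN: "is_weight N" and Y: "moore_penrose A Y"
  shows "impinv M N A = N ** Y ** M"
proof -
  note MM = is_weight_mult_self[OF wM] and NN = is_weight_mult_self[OF wN]
  have "N ** (N ** Y ** M) ** M = (N ** N) ** Y ** (M ** M)" by (simp add: matrix_mul_assoc)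
  then have sandwich: "N ** (N ** Y ** M) ** M = Y" by (simp add: MM NN)
  show ?thesis
    unfolding impinv_def
  proof (rule the_equality)
    show "imm M (imm N A (N ** Y ** M)) A = A \<and> imm N (imm M (N ** Y ** M) A) (N ** Y ** M) = N ** Y ** M
      \<and> iadj M M (imm N A (N ** Y ** M)) = imm N A (N ** Y ** M)
      \<and> iadj N N (imm M (N ** Y ** M) A) = imm M (N ** Y ** M) A"
      using indefinite_penrose_iff_moore_penrose[OF wM wN, of A "N ** Y ** M"] Y sandwich by simp
  next
    fix X assume "imm M (imm N A X) A = A \<and> imm N (imm M X A) X = X
      \<and> iadj M M (imm N A X) = imm N A X \<and> iadj N N (imm M X A) = imm M X A"
    then have "N ** X ** M = N ** (N ** Y ** M) ** M"
      using indefinite_penrose_iff_moore_penrose[OF wM wN] moore_penrose_unique Y sandwich by metis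
    then show "X = N ** Y ** M"
      using involution_sandwich_cancel[OF NN MM] by blast
  qed
qed

lemma moore_penrose_dual_image_subset:
  fixes A :: "real^'n^'m"
  assumes "moore_penrose A Y"
  shows "{x. \<forall>s\<in>S. 0 \<le> x \<bullet> (A *v s)}
    \<subseteq> {transpose Y *v y + z | y z. (\<forall>s\<in>S. 0 \<le> y \<bullet> s) \<and> transpose A *v z = 0}"
proof safe
  fix x assume dual: "\<forall>s\<in>S. 0 \<le> x \<bullet> (A *v s)"
  have "transpose Y ** transpose A = A ** Y"
    using assms unfolding moore_penrose_def by (metis matrix_transpose_mul)
  then have "transpose Y *v (transpose A *v x) = A *v (Y *v x)"
    by (metis matrix_vector_mul_assoc)
  then have "x = transpose Y *v (transpose A *v x) + (x - A *v (Y *v x))"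
    by simp
  moreover have "\<forall>s\<in>S. 0 \<le> (transpose A *v x) \<bullet> s"
    using dual by (simp add: inner_matrix_vector_transpose)
  moreover have "transpose A ** (A ** Y) = transpose A"
    using assms unfolding moore_penrose_def by (metis matrix_transpose_mul matrix_mul_assoc)
  then have "transpose A *v (A *v (Y *v x)) = transpose A *v x"
    by (metis matrix_vector_mul_assoc)
  then have "transpose A *v (x - A *v (Y *v x)) = 0"
    by (simp add: matrix_vector_mult_diff_distrib)
  ultimately show "\<exists>y z. x = transpose Y *v y + z \<and> (\<forall>s\<in>S. 0 \<le> y \<bullet> s) \<and> transpose A *v z = 0"
    by blast
qed

lemma moore_penrose_dual_image_eq:
  fixes A :: "real^'n^'m"
  assumes "moore_penrose A Y" and invariant: "\<And>s. s \<in> S \<Longrightarrow> Y *v (A *v s) \<in> S"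
  shows "{x. \<forall>s\<in>S. 0 \<le> x \<bullet> (A *v s)}
    = {transpose Y *v y + z | y z. (\<forall>s\<in>S. 0 \<le> y \<bullet> s) \<and> transpose A *v z = 0}"
proof
  show "{transpose Y *v y + z | y z. (\<forall>s\<in>S. 0 \<le> y \<bullet> s) \<and> transpose A *v z = 0}
    \<subseteq> {x. \<forall>s\<in>S. 0 \<le> x \<bullet> (A *v s)}"
  proof safe
    fix y z s assume y: "\<forall>s\<in>S. 0 \<le> y \<bullet> s" and z: "transpose A *v z = 0" and s: "s \<in> S"
    have "(transpose Y *v y) \<bullet> (A *v s) = y \<bullet> (Y *v (A *v s))"
      by (metis inner_matrix_vector_transpose inner_commute transpose_transpose)
    moreover have "z \<bullet> (A *v s) = (transpose A *v z) \<bullet> s"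
      by (rule inner_matrix_vector_transpose)
    ultimately have "(transpose Y *v y + z) \<bullet> (A *v s) = y \<bullet> (Y *v (A *v s)) + (transpose A *v z) \<bullet> s"
      by (simp add: inner_add_left)
    then show "0 \<le> (transpose Y *v y + z) \<bullet> (A *v s)"
      using y z invariant[OF s] by simp
  qed
qed (rule moore_penrose_dual_image_subset[OF assms(1)])

lemma is_weight_image_iff: "is_weight W \<Longrightarrow> x \<in> (*v) W ` K \<longleftrightarrow> W *v x \<in> K"
  by (auto simp: is_weight_mult_vec_self intro: rev_image_eqI[of "W *v x"])

lemma idual_imset_eq_dual_image:
  fixes M :: "real^'m^'m" and N :: "real^'n^'n" and A :: "real^'n^'m"
  assumes wN: "is_weight N" and intertwines: "M ** A = A ** N"
  shows "idual M (imset N (imm N A (mat 1)) K) = {x. \<forall>s\<in>(*v) N ` K. 0 \<le> x \<bullet> (A *v s)}"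
proof -
  have "imv N (imm N A (mat 1)) k = A *v k" for k
    unfolding imv_def imm_def
    by (simp add: matrix_vector_mul_assoc[symmetric] is_weight_mult_vec_self[OF wN])
  moreover have "M *v (A *v k) = A *v (N *v k)" for k
    by (simp add: matrix_vector_mul_assoc intertwines)
  ultimately show ?thesis
    unfolding idual_def imset_def by auto
qed

lemma msum_impinv_dual_null_eq:
  fixes M :: "real^'m^'m" and N :: "real^'n^'n" and A :: "real^'n^'m"
  assumes wM: "is_weight M" and wN: "is_weight N" and Y: "moore_penrose A Y"
  shows "msum (imset N (imm N (iadj N M (impinv M N A)) (mat 1)) (idual N K))
      (inull M (iadj M N (imm N A (mat 1))))
    = {transpose Y *v y + z | y z. (\<forall>s\<in>(*v) N ` K. 0 \<le> y \<bullet> s) \<and> transpose A *v z = 0}"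
proof -
  note simps = matrix_vector_mul_assoc[symmetric] matrix_transpose_mul transpose_mat
    is_weight_transpose[OF wM] is_weight_transpose[OF wN]
    is_weight_mult_vec_self[OF wM] is_weight_mult_vec_self[OF wN]
  have "imv N (imm N (iadj N M (impinv M N A)) (mat 1)) y = transpose Y *v y" for y
    unfolding impinv_eq_moore_penrose[OF wM wN Y] imv_def imm_def iadj_def by (simp add: simps)
  moreover have "imv M (iadj M N (imm N A (mat 1))) z = transpose A *v z" for z
    unfolding imv_def imm_def iadj_def by (simp add: simps)
  ultimately show ?thesis
    unfolding msum_def imset_def inull_def idual_def by auto
qed

lemma imset_impinv_subset_iff:
  fixes M :: "real^'m^'m" and N :: "real^'n^'n" and A :: "real^'n^'m"
  assumes wM: "is_weight M" and wN: "is_weight N" and Y: "moore_penrose A Y"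
  shows "imset N (imm M (impinv M N A) A) K \<subseteq> K
    \<longleftrightarrow> (\<forall>s\<in>(*v) N ` K. Y *v (A *v s) \<in> (*v) N ` K)"
proof -
  have "imv N (imm M (impinv M N A) A) k = N *v (Y *v (A *v (N *v k)))" for k
    unfolding impinv_eq_moore_penrose[OF wM wN Y] imv_def imm_def
    by (simp add: matrix_vector_mul_assoc[symmetric] is_weight_mult_vec_self[OF wM])
  then show ?thesis
    unfolding imset_def using is_weight_image_iff[OF wN] by auto
qed

theorem theorem3p4:
  fixes M :: "real^'m^'m" and N :: "real^'n^'n" and A :: "real^'n^'m"
    and K :: "(real^'n) set"
  assumes "is_weight M" and "is_weight N" and "M ** A = A ** N"
    and "is_cone K" and "closed K"
  shows "idual M (imset N (imm N A (mat 1)) K)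
           \<subseteq> msum (imset N (imm N (iadj N M (impinv M N A)) (mat 1)) (idual N K))
                   (inull M (iadj M N (imm N A (mat 1))))
         \<and> (imset N (imm M (impinv M N A) A) K \<subseteq> K \<longrightarrow>
            idual M (imset N (imm N A (mat 1)) K)
              = msum (imset N (imm N (iadj N M (impinv M N A)) (mat 1)) (idual N K))
                     (inull M (iadj M N (imm N A (mat 1)))))"
proof -
  obtain Y where Y: "moore_penrose A Y" using moore_penrose_exists .
  note dual = idual_imset_eq_dual_image[OF assms(2,3)]
    and sum = msum_impinv_dual_null_eq[OF assms(1,2) Y]
    and invariant = imset_impinv_subset_iff[OF assms(1,2) Y]
  show ?thesis
    unfolding dual sum invariant
    using moore_penrose_dual_image_subset[OF Y, of "(*v) N ` K"]
      moore_penrose_dual_image_eq[OF Y, of "(*v) N ` K"] by blast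
qed

end
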